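(* Let $s\ge 1$ be an integer and let $G$ be a finite graph. In each of the following cases, there exists an optimal coloring of $G$ such that every tree on $s$ vertices occurs as an induced rainbow subgraph of $G$: (i) $G$ is $K_{2,r}$-free for some integer $r\ge 2$ and $\chi(G)\ge (r-1)(s-1)s/2+s$; (ii) $G$ has girth $g\ge 5$ and $\chi(G)\ge s^{1+4/(g-4)}$.
   Context: An optimal coloring is a proper vertex coloring using exactly $\chi(G)$ colors. $G$ is $K_{2,r}$-free if it has no subgraph (not necessarily induced) isomorphic to $K_{2,r}$. An induced rainbow subgraph is an induced subgraph whose vertices have pairwise distinct colors. *)

theory Defs
  imports
    Complex_Main
    "HOL-Library.Extended_Nat"
    "Graph_Theory.Digraph_Component"
    "Graph_Theory.Digraph_Isomorphism"
    "Graph_Theory.Kuratowski"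
begin

(* Finite simple graphs are the symmetric digraphs of the locale graph: finite, loop-free, without
   parallel arcs, and with each undirected edge uv given by the two arcs from u to v and from v
   to u. The predicate cycle of Arc_Walk also holds for the closed walk u, v, u along a single
   edge, so Digraph_Component.tree fails for every symmetric digraph with an edge. Requiring
   length at least 3 leaves exactly the cycles of the undirected graph. *)

definition undirected_cycle :: "('a, 'b) pre_digraph \<Rightarrow> 'b list \<Rightarrow> bool" where
  "undirected_cycle G p \<longleftrightarrow> pre_digraph.cycle G p \<and> 3 \<le> length p"

(* Digraph_Component.connected (not the topological notion) includes verts T \<noteq> {}. *)
definition undirected_tree :: "('a, 'b) pre_digraph \<Rightarrow> bool" where
  "undirected_tree T \<longleftrightarrow>
     graph T \<and> Digraph_Component.connected T \<and> \<not> (\<exists>p. undirected_cycle T p)"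

(* The girth of a forest is \<infinity>, the infimum of the empty set. *)
definition girth :: "('a, 'b) pre_digraph \<Rightarrow> enat" where
  "girth G = (INF p \<in> {p. undirected_cycle G p}. enat (length p))"

(* The value at \<infinity> reads 4 / (\<infinity> - 4) as 0. *)
definition girth_exponent :: "enat \<Rightarrow> real" where
  "girth_exponent g = (case g of enat n \<Rightarrow> 1 + 4 / (real n - 4) | \<infinity> \<Rightarrow> 1)"

definition proper_coloring :: "('a, 'b) pre_digraph \<Rightarrow> ('a \<Rightarrow> nat) \<Rightarrow> bool" where
  "proper_coloring G c \<longleftrightarrow> (\<forall>(u, v) \<in> arcs_ends G. c u \<noteq> c v)"

(* Meaningful only for finite verts G, as card is 0 on infinite sets. *)
definition chromatic_number :: "('a, 'b) pre_digraph \<Rightarrow> nat" where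
  "chromatic_number G = (LEAST k. \<exists>c. proper_coloring G c \<and> card (c ` verts G) = k)"

definition optimal_coloring :: "('a, 'b) pre_digraph \<Rightarrow> ('a \<Rightarrow> nat) \<Rightarrow> bool" where
  "optimal_coloring G c \<longleftrightarrow>
     proper_coloring G c \<and> card (c ` verts G) = chromatic_number G"

(* complete_bipartite_digraph is already closed under isomorphism. *)
definition K2_free :: "nat \<Rightarrow> ('a, 'b) pre_digraph \<Rightarrow> bool" where
  "K2_free r G \<longleftrightarrow> \<not> (\<exists>H. subgraph H G \<and> complete_bipartite_digraph 2 r H)"

definition occurs_induced_rainbow ::
  "('c, 'd) pre_digraph \<Rightarrow> ('a, 'b) pre_digraph \<Rightarrow> ('a \<Rightarrow> nat) \<Rightarrow> bool" where
  "occurs_induced_rainbow T G c \<longleftrightarrow>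
     (\<exists>H. induced_subgraph H G \<and> inj_on c (verts H) \<and> digraph_iso T H)"

end

theory Submission
  imports Defs
begin

text \<open>
  Among the optimal colorings choose one with minimal colour sum: then every vertex has a neighbour
  in each smaller colour. Start at a vertex of the largest colour and embed the tree leaf by leaf:
  to attach a leaf at an embedded vertex \<open>v\<close>, take the largest unused colour below that of \<open>v\<close> for
  which the neighbour of \<open>v\<close> of that colour has no second neighbour in the image \<open>W\<close>. All skipped
  colours belong to vertices outside \<open>W\<close> with at least two neighbours in \<open>W\<close>, so the process can
  only get stuck if \<open>|W|\<close> plus the number of these vertices reaches the chromatic number.

  If \<open>G\<close> is \<open>K\<^bsub>2,r\<^esub>\<close>-free, each pair in \<open>W\<close> has at most \<open>r - 1\<close> common neighbours. If \<open>G\<close> has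
  large girth, replace each such vertex by an edge between two of its neighbours in \<open>W\<close> and add the
  tree edges. The resulting graph on \<open>W\<close> has girth at least half of that of \<open>G\<close>, and the Moore-type
  bound below limits its number of edges.
\<close>

section \<open>Paths and girth\<close>

text \<open>A path is the list of its vertices, so it has \<open>length p - 1\<close> edges; a
  single vertex is a path for every \<open>E\<close>.\<close>

definition gpath :: "('a \<times> 'a) set \<Rightarrow> 'a list \<Rightarrow> bool" where
  "gpath E p \<longleftrightarrow> p \<noteq> [] \<and> distinct p \<and> successively (\<lambda>x y. (x, y) \<in> E) p"

text \<open>A form of girth greater than \<open>n\<close> that suits counting arguments: two
  different paths with common ends and at most \<open>n\<close> edges together would close a short
  cycle. The \<open>+ 2\<close> converts vertices into edges.\<close>

definition unique_paths :: "('a \<times> 'a) set \<Rightarrow> nat \<Rightarrow> bool" where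
  "unique_paths E n \<longleftrightarrow>
     (\<forall>p q. gpath E p \<and> gpath E q \<and> hd p = hd q \<and> last p = last q \<and>
            length p + length q \<le> n + 2 \<longrightarrow> p = q)"

lemma unique_pathsD:
  assumes "unique_paths E n" "gpath E p" "gpath E q" "hd p = hd q" "last p = last q"
    "length p + length q \<le> n + 2"
  shows "p = q"
  using assms unfolding unique_paths_def by blast

lemma unique_paths_mono:
  assumes "unique_paths E n" "m \<le> n"
  shows "unique_paths E m"
  using assms unfolding unique_paths_def by (meson add_le_mono1 order_trans)

lemma gpath_mono: "gpath E p \<Longrightarrow> E \<subseteq> F \<Longrightarrow> gpath F p"
  unfolding gpath_def by (auto intro: successively_mono)

lemma unique_paths_subset: "unique_paths E n \<Longrightarrow> F \<subseteq> E \<Longrightarrow> unique_paths F n"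
  unfolding unique_paths_def by (meson gpath_mono)

lemma gpath_snoc:
  "gpath E (p @ [w]) \<longleftrightarrow> p = [] \<or> gpath E p \<and> w \<notin> set p \<and> (last p, w) \<in> E"
  unfolding gpath_def by (auto simp: successively_append_iff)

lemma gpath_Cons:
  "gpath E (a # p) \<longleftrightarrow> p = [] \<or> gpath E p \<and> a \<notin> set p \<and> (a, hd p) \<in> E"
  unfolding gpath_def by (cases p) auto

lemma gpath_rev: "sym E \<Longrightarrow> gpath E p \<Longrightarrow> gpath E (rev p)"
  unfolding gpath_def by (auto simp: sym_def elim: successively_mono)

text \<open>Drop the common start of both paths. From the last common vertex \<open>a\<close> of
  that start, follow \<open>q\<close> until it first meets \<open>p\<close> again, and return along
  \<open>p\<close>. Both ends of this detour are counted in \<open>p\<close> and in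
  \<open>q\<close>, which saves two in the length.\<close>

lemma two_gpaths_cycle:
  assumes "sym E" "gpath E p" "gpath E q" "hd p = hd q" "last p = last q" "p \<noteq> q"
  shows "\<exists>c. gpath E c \<and> (last c, hd c) \<in> E \<and> 3 \<le> length c \<and> length c + 2 \<le> length p + length q"
  using assms
proof (induction p arbitrary: q)
  case Nil
  then show ?case by (simp add: gpath_def)
next
  case (Cons a p)
  then obtain q' where q: "q = a # q'"
    by (cases q) (auto simp: gpath_def)
  have ne: "p \<noteq> []" "q' \<noteq> []"
    using Cons.prems last_in_set[of p] last_in_set[of q'] by (auto simp: q gpath_def split: if_splits)
  show ?case
  proof (cases "hd p = hd q'")
    case True
    then show ?thesis
      using Cons.IH[of q'] Cons.prems ne unfolding q by (fastforce simp: gpath_Cons)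
  next
    case False
    have "last q' \<in> set p \<inter> set q'"
      using Cons.prems(5) ne by (metis IntI last.simps last_in_set q)
    then obtain q1 z q2 where q': "q' = q1 @ z # q2" and z: "z \<in> set p" and q1: "\<forall>y\<in>set q1. y \<notin> set p"
      using split_list_first_prop[of q' "\<lambda>y. y \<in> set p"] by blast
    from z obtain p1 p2 where p: "p = p1 @ z # p2"
      by (meson split_list)
    \<comment> \<open>From \<open>a\<close> along \<open>p\<close> to \<open>z\<close>, then
      backwards along \<open>q\<close>; the edge back to \<open>a\<close> closes the cycle.\<close>
    let ?c = "a # p1 @ z # rev q1"
    have sy: "\<And>x y. (x, y) \<in> E \<longleftrightarrow> (y, x) \<in> E"
      using \<open>sym E\<close> by (meson symD)
    let ?P = "\<lambda>x y. (x, y) \<in> E"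
    have "successively ?P (a # p1 @ [z])"
      using Cons.prems(2) successively_append_iff[of ?P "a # p1 @ [z]" p2] unfolding p gpath_def by simp
    moreover have "successively ?P (a # q1 @ [z])"
      using Cons.prems(3) successively_append_iff[of ?P "a # q1 @ [z]" q2] unfolding q q' gpath_def by simp
    then have "successively ?P (rev (a # q1 @ [z]))"
      unfolding successively_rev by (rule successively_mono) (use sy in auto)
    then have rq: "successively ?P (z # rev q1 @ [a])" by simp
    then have "successively ?P (z # rev q1)"
      using successively_append_iff[of ?P "z # rev q1" "[a]"] by simp
    ultimately have "successively ?P ?c"
      using successively_append_iff[of ?P "a # p1 @ [z]" "rev q1"] successively_append_iff[of ?P "[z]" "rev q1"]
      by simp
    moreover have "distinct ?c"
      using Cons.prems q1 unfolding q p q' gpath_def by auto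
    ultimately have "gpath E ?c" by (simp add: gpath_def)
    moreover have "(last ?c, hd ?c) \<in> E"
      using rq successively_append_iff[of ?P "z # rev q1" "[a]"] by simp
    \<comment> \<open>The paths part right after \<open>a\<close>, so \<open>z\<close> cannot be the
      second vertex of both, which excludes a single edge run to and fro.\<close>
    moreover have "p1 \<noteq> [] \<or> q1 \<noteq> []"
      using False p q' by auto
    then have "3 \<le> length ?c"
      by (cases p1; cases q1) auto
    moreover have "length ?c + 2 \<le> length (a # p) + length q"
      by (simp add: q p q')
    ultimately show ?thesis by blast
  qed
qed

lemma unique_pathsI:
  assumes "sym E"
    and "\<And>c. gpath E c \<Longrightarrow> (last c, hd c) \<in> E \<Longrightarrow> 3 \<le> length c \<Longrightarrow> n < length c"
  shows "unique_paths E n"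
  unfolding unique_paths_def
proof (intro allI impI, elim conjE, rule ccontr)
  fix p q assume "gpath E p" "gpath E q" "hd p = hd q" "last p = last q"
    and len: "length p + length q \<le> n + 2" and "p \<noteq> q"
  then obtain c where "gpath E c" "(last c, hd c) \<in> E" "3 \<le> length c"
    and "length c + 2 \<le> length p + length q"
    using two_gpaths_cycle[OF assms(1)] by meson
  with assms(2) len show False by fastforce
qed

lemma unique_paths_triangle:
  assumes "unique_paths E 3" "irrefl E" "(a, u) \<in> E" "(u, b) \<in> E" "a \<noteq> b"
  shows "(a, b) \<notin> E"
proof
  assume "(a, b) \<in> E"
  then have "gpath E [a, b]" "gpath E [a, u, b]"
    using assms by (auto simp: gpath_def irrefl_def)
  from unique_pathsD[OF assms(1) this] show False by simp
qed

text \<open>Two common neighbours would give two paths of two edges each, that is, a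
  four-cycle.\<close>

lemma unique_paths_common_neighbour:
  assumes "unique_paths E 4" "irrefl E" "(a, u) \<in> E" "(u, b) \<in> E" "(a, v) \<in> E" "(v, b) \<in> E" "a \<noteq> b"
  shows "u = v"
proof -
  have "gpath E [a, u, b]" "gpath E [a, v, b]"
    using assms by (auto simp: gpath_def irrefl_def)
  from unique_pathsD[OF assms(1) this] show ?thesis by simp
qed

section \<open>The Moore bound by ball growing\<close>

fun gball :: "('a \<times> 'a) set \<Rightarrow> 'a \<Rightarrow> nat \<Rightarrow> 'a set" where
  "gball A v 0 = {v}"
| "gball A v (Suc i) = gball A v i \<union> A `` gball A v i"

lemma gball_mono: "i \<le> j \<Longrightarrow> gball A v i \<subseteq> gball A v j"
  by (rule lift_Suc_mono_le[of "gball A v"]) auto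

lemma centre_in_gball: "v \<in> gball A v i"
  using gball_mono[of 0 i] by auto

lemma gball_subset: "A \<subseteq> V \<times> V \<Longrightarrow> v \<in> V \<Longrightarrow> gball A v i \<subseteq> V"
  by (induction i) auto

text \<open>Keeping the path inside the ball allows any vertex outside to be appended to it.\<close>

lemma gball_gpath:
  "w \<in> gball A v i \<Longrightarrow>
     \<exists>p. gpath A p \<and> hd p = v \<and> last p = w \<and> set p \<subseteq> gball A v i \<and> length p \<le> Suc i"
proof (induction i arbitrary: w)
  case 0
  then show ?case by (intro exI[of _ "[v]"]) (auto simp: gpath_def)
next
  case (Suc i)
  show ?case
  proof (cases "w \<in> gball A v i")
    case True
    then show ?thesis using Suc.IH[of w] by fastforce
  next
    case False
    then obtain a where a: "a \<in> gball A v i" "(a, w) \<in> A"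
      using Suc.prems by auto
    then obtain p where p: "gpath A p" "hd p = v" "last p = a" "set p \<subseteq> gball A v i" "length p \<le> Suc i"
      using Suc.IH by blast
    then have "p \<noteq> []" by (simp add: gpath_def)
    then show ?thesis
      using p a False Suc.prems by (intro exI[of _ "p @ [w]"]) (auto simp: gpath_snoc)
  qed
qed

text \<open>The path to \<open>a\<close> prolonged by the edge to \<open>b\<close>, and the path to
  \<open>b\<close>, would have at most \<open>2 * i + 1\<close> edges together. They differ because
  their inner parts stay in radius \<open>i - 1\<close>, which contains neither \<open>a\<close> nor
  \<open>b\<close>.\<close>

lemma gball_edge_same_layer:
  assumes "unique_paths A (2 * i + 1)" "irrefl A"
    and "a \<in> gball A v i" "b \<in> gball A v i" "\<And>j. j < i \<Longrightarrow> a \<notin> gball A v j \<and> b \<notin> gball A v j"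
  shows "(a, b) \<notin> A"
proof
  assume ab: "(a, b) \<in> A"
  then have neq: "a \<noteq> b" using assms(2) by (auto simp: irrefl_def)
  with assms(3,4) obtain j where j: "i = Suc j" by (cases i) auto
  then have out: "a \<notin> gball A v j" "b \<notin> gball A v j" using assms(5) by auto
  have path: "\<exists>p. gpath A p \<and> gpath A (p @ [w]) \<and> hd p = v \<and> set p \<subseteq> gball A v j \<and> length p \<le> i"
    if w: "w \<in> gball A v i" "w \<notin> gball A v j" for w
  proof -
    obtain w' where "w' \<in> gball A v j" "(w', w) \<in> A" using w unfolding j by auto
    then show ?thesis using gball_gpath[of w' A v j] w j by (metis gpath_snoc subsetD)
  qed
  obtain p where p: "gpath A p" "gpath A (p @ [a])" "hd p = v" "set p \<subseteq> gball A v j" "length p \<le> i"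
    using path[OF assms(3) out(1)] by blast
  obtain q where q: "gpath A q" "gpath A (q @ [b])" "hd q = v" "set q \<subseteq> gball A v j" "length q \<le> i"
    using path[OF assms(4) out(2)] by blast
  have ne: "p \<noteq> []" "q \<noteq> []" using p q by (auto simp: gpath_def)
  have "gpath A (p @ [a, b])"
    using gpath_snoc[of A "p @ [a]" b] p(2,4) ab neq out by auto
  then have "p @ [a, b] = q @ [b]"
    using q p ne by (intro unique_pathsD[OF assms(1)]) auto
  then have "q = p @ [a]" by simp
  then show False using q(4) out by simp
qed

text \<open>Paths through \<open>a\<close> and through \<open>a'\<close> to \<open>b\<close> have at
  most \<open>i + 1\<close> edges each and hence agree.\<close>

lemma gball_unique_parent:
  assumes "unique_paths A (2 * i + 2)"
    and "a \<in> gball A v i" "a' \<in> gball A v i" "b \<notin> gball A v i" "(a, b) \<in> A" "(a', b) \<in> A"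
  shows "a = a'"
proof -
  obtain p where p: "gpath A p" "hd p = v" "last p = a" "set p \<subseteq> gball A v i" "length p \<le> Suc i"
    using gball_gpath[OF assms(2)] by blast
  obtain q where q: "gpath A q" "hd q = v" "last q = a'" "set q \<subseteq> gball A v i" "length q \<le> Suc i"
    using gball_gpath[OF assms(3)] by blast
  have ne: "p \<noteq> []" "q \<noteq> []" using p q by (auto simp: gpath_def)
  have "p @ [b] = q @ [b]"
    using p q ne assms by (intro unique_pathsD[OF assms(1)]) (auto simp: gpath_snoc)
  then show ?thesis using p q by simp
qed

text \<open>Every edge that meets the ball joins consecutive layers, and its outer end determines
  it. That end is never the centre, so there are fewer edges than vertices in the next ball, and
  each edge counts as two arcs.\<close>

lemma card_arcs_at_gball:
  assumes "finite A" "sym A" "irrefl A" "unique_paths A (2 * i + 2)"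
  shows "card {(a, b) \<in> A. a \<in> gball A v i \<or> b \<in> gball A v i} + 2 \<le> 2 * card (gball A v (Suc i))"
proof -
  let ?B = "gball A v"
  define D where "D = {(a, b) \<in> A. \<exists>j\<le>i. a \<in> ?B j \<and> b \<in> ?B (Suc j) - ?B j}"
  have fin: "finite (?B n)" for n
    using \<open>finite A\<close> by (induction n) auto
  have "inj_on snd D"
  proof (rule inj_onI)
    fix e e' assume e: "e \<in> D" "e' \<in> D" "snd e = snd e'"
    obtain a b j where 1: "e = (a, b)" "(a, b) \<in> A" "j \<le> i" "a \<in> ?B j" "b \<in> ?B (Suc j)" "b \<notin> ?B j"
      using e(1) unfolding D_def by blast
    obtain a' j' where 2: "e' = (a', b)" "(a', b) \<in> A" "j' \<le> i" "a' \<in> ?B j'" "b \<in> ?B (Suc j')" "b \<notin> ?B j'"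
      using e(2,3) 1(1) unfolding D_def by (cases e') (simp del: gball.simps, blast)
    \<comment> \<open>The vertex \<open>b\<close> is new in one layer only.\<close>
    have "\<not> Suc j \<le> j'" "\<not> Suc j' \<le> j"
      using 1 2 gball_mono[of "Suc j" j' A v] gball_mono[of "Suc j'" j A v] by blast+
    then have "j' = j" by simp
    then have "a = a'"
      using gball_unique_parent[of A j a v a' b] unique_paths_mono[OF assms(4), of "2 * j + 2"] 1 2 by auto
    then show "e = e'" using 1 2 by simp
  qed
  then have "card D = card (snd ` D)" by (simp add: card_image)
  also have "\<dots> \<le> card (?B (Suc i) - {v})"
  proof (rule card_mono)
    show "snd ` D \<subseteq> ?B (Suc i) - {v}"
      using gball_mono[of "Suc _" "Suc i" A v] centre_in_gball[of v A] unfolding D_def by fastforce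
  qed (use fin[of "Suc i"] in auto)
  also have "\<dots> = card (?B (Suc i)) - 1"
    using centre_in_gball[of v A "Suc i"] by (simp only: card_Diff_singleton)
  finally have cD: "card D \<le> card (?B (Suc i)) - 1" .
  have finD: "finite D" using \<open>finite A\<close> by (rule finite_subset[rotated]) (auto simp: D_def)
  have key: "(a, b) \<in> D \<union> D\<inverse>" if ab: "(a, b) \<in> A" "a \<in> ?B i" for a b
  proof -
    have ba: "(b, a) \<in> A" using ab \<open>sym A\<close> by (meson symD)
    have b: "b \<in> ?B (Suc i)" using ab by auto
    \<comment> \<open>\<open>j\<close> and \<open>l\<close> are the distances of \<open>a\<close>
      and \<open>b\<close> from \<open>v\<close>. They differ by at most one and are not
      equal.\<close>
    define j where "j = (LEAST j. a \<in> ?B j)"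
    define l where "l = (LEAST l. b \<in> ?B l)"
    have j: "a \<in> ?B j" "j \<le> i" "\<And>n. n < j \<Longrightarrow> a \<notin> ?B n"
      unfolding j_def using ab(2) by (auto intro: LeastI Least_le dest: not_less_Least)
    have l: "b \<in> ?B l" "\<And>n. n < l \<Longrightarrow> b \<notin> ?B n"
      unfolding l_def using b by (auto intro: LeastI simp del: gball.simps dest: not_less_Least)
    have "b \<in> ?B (Suc j)" "a \<in> ?B (Suc l)"
      using j(1) l(1) ab ba by auto
    then have "l \<le> Suc j" "j \<le> Suc l"
      using j(3) l(2) by (meson not_less)+
    then consider "l = Suc j" | "j = Suc l" | "j = l" by linarith
    then show ?thesis
    proof cases
      case 1
      then have "(a, b) \<in> D" using j l ab unfolding D_def by (auto simp del: gball.simps)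
      then show ?thesis by blast
    next
      case 2
      then have "(b, a) \<in> D" using j l ba unfolding D_def by (auto simp del: gball.simps intro!: exI[of _ l])
      then show ?thesis by blast
    next
      case 3
      then have "(a, b) \<notin> A"
        using gball_edge_same_layer[of A j a v b] unique_paths_mono[OF assms(4), of "2 * j + 1"] j l assms(3)
        by auto
      then show ?thesis using ab by simp
    qed
  qed
  have "{(a, b) \<in> A. a \<in> ?B i \<or> b \<in> ?B i} \<subseteq> D \<union> D\<inverse>"
    using key \<open>sym A\<close> by (auto dest: symD)
  then have "card {(a, b) \<in> A. a \<in> ?B i \<or> b \<in> ?B i} \<le> card (D \<union> D\<inverse>)"
    using finD by (intro card_mono) auto
  also have "\<dots> \<le> card D + card (D\<inverse>)" by (rule card_Un_le)
  also have "\<dots> = 2 * card D" by simp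
  finally have "card {(a, b) \<in> A. a \<in> ?B i \<or> b \<in> ?B i} \<le> 2 * card D" .
  moreover have "0 < card (?B (Suc i))"
    using centre_in_gball[of v A "Suc i"] fin[of "Suc i"] by (simp only: card_gt_0_iff) blast
  ultimately show ?thesis using cD by linarith
qed

text \<open>
  Some ball \<open>B\<close> of radius \<open>i < q\<close> grows by a factor of at most \<open>x\<close> in the next step. The edges meeting
  \<open>B\<close> form a tree inside the ball of radius \<open>i + 1\<close>, so there are fewer than \<open>x |B|\<close> of them; delete
  \<open>B\<close> and iterate.
\<close>
lemma moore_bound:
  fixes x :: real
  assumes "finite V" "A \<subseteq> V \<times> V" "sym A" "irrefl A" "unique_paths A (2 * q)"
    and "1 \<le> q" "0 < x" "real (card V) \<le> x ^ q" "V \<noteq> {}"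
  shows "real (card A) + 2 \<le> 2 * x * real (card V)"
  using assms
proof (induction V arbitrary: A rule: finite_psubset_induct)
  case (psubset V)
  let ?B = "gball A"
  obtain v where v: "v \<in> V" using psubset.prems by blast
  have sub: "?B v n \<subseteq> V" for n using gball_subset[OF psubset.prems(1) v] .
  have finA: "finite A" using psubset.hyps psubset.prems(1) by (meson finite_SigmaI finite_subset)
  \<comment> \<open>If each of the first \<open>q\<close> steps multiplied the size by more than
    \<open>x\<close>, the ball of radius \<open>q\<close> would have more than \<open>x ^ q\<close>
    vertices.\<close>
  have "\<exists>i<q. real (card (?B v (Suc i))) \<le> x * real (card (?B v i))"
  proof (rule ccontr)
    assume "\<not> ?thesis"
    then have big: "x * real (card (?B v i)) < real (card (?B v (Suc i)))" if "i < q" for i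
      using that by (meson not_less)
    \<comment> \<open>The inequality is strict only after the first step; \<open>1 \<le> q\<close>
      makes this enough.\<close>
    have "x ^ i \<le> real (card (?B v i)) \<and> (0 < i \<longrightarrow> x ^ i < real (card (?B v i)))" if "i \<le> q" for i
      using that
    proof (induction i)
      case (Suc i)
      then have "x * x ^ i \<le> x * real (card (?B v i))" using \<open>0 < x\<close> by (intro mult_left_mono) auto
      also have "\<dots> < real (card (?B v (Suc i)))" using big Suc.prems by (simp del: gball.simps)
      finally show ?case by (simp del: gball.simps)
    qed auto
    from this[of q] have "x ^ q < real (card (?B v q))" using psubset.prems by auto
    also have "\<dots> \<le> real (card V)" using sub[of q] psubset.hyps by (simp add: card_mono)
    finally show False using psubset.prems by simp
  qed
  then obtain i where i: "i < q" "real (card (?B v (Suc i))) \<le> x * real (card (?B v i))" by blast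
  let ?D = "{(a, b) \<in> A. a \<in> ?B v i \<or> b \<in> ?B v i}"
  have "unique_paths A (2 * i + 2)" using i by (intro unique_paths_mono[OF psubset.prems(4)]) simp
  then have "card ?D + 2 \<le> 2 * card (?B v (Suc i))"
    by (rule card_arcs_at_gball[OF finA psubset.prems(2,3)])
  then have D: "real (card ?D) + 2 \<le> 2 * x * real (card (?B v i))" using i by linarith
  define V' where "V' = V - ?B v i"
  define A' where "A' = A \<inter> V' \<times> V'"
  have A: "card A \<le> card ?D + card A'"
  proof -
    have "A \<subseteq> ?D \<union> A'" using psubset.prems(1) by (auto simp: A'_def V'_def)
    then have "card A \<le> card (?D \<union> A')"
      using finA by (intro card_mono) (auto simp: A'_def intro: finite_subset)
    also have "\<dots> \<le> card ?D + card A'" by (rule card_Un_le)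
    finally show ?thesis .
  qed
  have V: "card V = card (?B v i) + card V'"
    unfolding V'_def using sub[of i] psubset.hyps
    by (metis card_Diff_subset card_mono finite_subset le_add_diff_inverse)
  show ?case
  proof (cases "V' = {}")
    case True
    then show ?thesis using A D V by (simp add: A'_def)
  next
    case False
    have "V' \<subset> V" using v centre_in_gball[of v A i] by (auto simp: V'_def)
    moreover have "sym A'" "irrefl A'"
      using psubset.prems by (auto simp: A'_def sym_def irrefl_def)
    moreover have "unique_paths A' (2 * q)"
      using psubset.prems(4) by (rule unique_paths_subset) (auto simp: A'_def)
    ultimately have "real (card A') + 2 \<le> 2 * x * real (card V')"
      using psubset.prems False V by (intro psubset.IH) (auto simp: A'_def)
    then show ?thesis using A D V by (simp add: algebra_simps)
  qed
qed

section \<open>Vertices with several neighbours in a set\<close>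

text \<open>The vertices that cannot become the image of a new leaf over the image \<open>W\<close>,
  because they would create a second edge into \<open>W\<close>.\<close>

definition multi_nbrs :: "('a \<times> 'a) set \<Rightarrow> 'a set \<Rightarrow> 'a set" where
  "multi_nbrs E W = {u. u \<notin> W \<and> (\<exists>a\<in>W. \<exists>b\<in>W. a \<noteq> b \<and> (a, u) \<in> E \<and> (b, u) \<in> E)}"

lemma finite_multi_nbrs: "finite E \<Longrightarrow> finite (multi_nbrs E W)"
  by (rule finite_subset[of _ "snd ` E"]) (force simp: multi_nbrs_def)+

text \<open>A union bound over the pairs in \<open>W\<close>, since each vertex counted is a common
  neighbour of some pair.\<close>

lemma card_multi_nbrs_le_choose:
  assumes "finite W"
    and "\<And>a b. a \<in> W \<Longrightarrow> b \<in> W \<Longrightarrow> a \<noteq> b \<Longrightarrow>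
           finite {u. (a, u) \<in> E \<and> (b, u) \<in> E} \<and> card {u. (a, u) \<in> E \<and> (b, u) \<in> E} \<le> t"
  shows "card (multi_nbrs E W) \<le> (card W choose 2) * t"
proof -
  let ?P = "{S. S \<subseteq> W \<and> card S = 2}"
  let ?N = "\<lambda>S. {u. \<forall>a\<in>S. (a, u) \<in> E}"
  have finP: "finite ?P" using assms(1) by simp
  have N: "finite (?N S) \<and> card (?N S) \<le> t" if "S \<in> ?P" for S
  proof -
    from that obtain a b where "S = {a, b}" "a \<noteq> b" by (auto simp: card_2_iff)
    then show ?thesis using assms(2)[of a b] that by auto
  qed
  have "multi_nbrs E W \<subseteq> (\<Union>S\<in>?P. ?N S)"
  proof
    fix u assume "u \<in> multi_nbrs E W"
    then obtain a b where "a \<in> W" "b \<in> W" "a \<noteq> b" "(a, u) \<in> E" "(b, u) \<in> E"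
      by (auto simp: multi_nbrs_def)
    then show "u \<in> (\<Union>S\<in>?P. ?N S)" by (intro UN_I[of "{a, b}"]) auto
  qed
  then have "card (multi_nbrs E W) \<le> card (\<Union>S\<in>?P. ?N S)"
    using finP N by (intro card_mono) auto
  also have "\<dots> \<le> (\<Sum>S\<in>?P. card (?N S))" by (rule card_UN_le[OF finP])
  also have "\<dots> \<le> (\<Sum>S\<in>?P. t)" using N by (intro sum_mono) auto
  also have "\<dots> = (card W choose 2) * t" using n_subsets[OF assms(1), of 2] by simp
  finally show ?thesis .
qed

lemma gpath_subset: "gpath A p \<Longrightarrow> A \<subseteq> W \<times> W \<Longrightarrow> hd p \<in> W \<Longrightarrow> set p \<subseteq> W"
proof (induction p)
  case (Cons a p)
  then show ?case by (cases "p = []") (auto simp: gpath_Cons)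
qed (simp add: gpath_def)

lemma gpath_hd_last: "gpath A p \<Longrightarrow> hd p = last p \<Longrightarrow> p = [hd p]"
  by (cases p) (auto simp: gpath_def split: if_splits)

(* Subdividing the edges N of the auxiliary graph A by the vertices they come from turns a path in A
   into a path in E of at most twice the length. *)
lemma card_multi_nbrs_le_power:
  fixes x :: real
  assumes E: "sym E" "irrefl E" "finite E" and W: "finite W" "W \<noteq> {}"
    and up: "unique_paths E (4 * q)" and q: "1 \<le> q"
    and x: "0 < x" "real (card W) \<le> x ^ q"
    and edges: "2 * card W \<le> card (E \<inter> W \<times> W) + 2"
  shows "real (card W) + real (card (multi_nbrs E W)) \<le> x * real (card W)"
proof -
  define M where "M = multi_nbrs E W"
  have "\<forall>u\<in>M. \<exists>a b. a \<in> W \<and> b \<in> W \<and> a \<noteq> b \<and> (a, u) \<in> E \<and> (b, u) \<in> E"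
    by (auto simp: M_def multi_nbrs_def)
  \<comment> \<open>The pair of \<open>f u\<close> and \<open>g u\<close> is the auxiliary edge that
    replaces \<open>u\<close>.\<close>
  then obtain f g where fg: "\<And>u. u \<in> M \<Longrightarrow> f u \<in> W \<and> g u \<in> W \<and> f u \<noteq> g u \<and> (f u, u) \<in> E \<and> (g u, u) \<in> E"
    by metis
  have sy: "(b, a) \<in> E" if "(a, b) \<in> E" for a b using that E(1) by (meson symD)
  have up3: "unique_paths E 3" and up4: "unique_paths E 4"
    using up q by (auto intro: unique_paths_mono)
  have MW: "u \<notin> W" if "u \<in> M" for u using that by (auto simp: M_def multi_nbrs_def)
  have finM: "finite M" unfolding M_def using E(3) by (rule finite_multi_nbrs)
  define N where "N = (\<lambda>u. (f u, g u)) ` M"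
  define A where "A = E \<inter> W \<times> W \<union> (N \<union> N\<inverse>)"
  \<comment> \<open>Equal pairs for different vertices would form a four-cycle.\<close>
  have uniq: "u = v" if "u \<in> M" "v \<in> M" "{f u, g u} = {f v, g v}" for u v
  proof (rule unique_paths_common_neighbour[OF up4 E(2)])
    show "(f u, u) \<in> E" "(u, g u) \<in> E" "f u \<noteq> g u" using fg[OF that(1)] sy by auto
    show "(f u, v) \<in> E" "(v, g u) \<in> E" using fg[OF that(2)] that(3) sy by (auto simp: doubleton_eq_iff)
  qed
  \<comment> \<open>An auxiliary edge that is already in \<open>E\<close> would form a triangle with
    \<open>u\<close>. So the two kinds of arcs are counted separately.\<close>
  have NE: "N \<inter> E = {}" "N\<inverse> \<inter> E = {}"
  proof -
    have "(f u, g u) \<notin> E" if "u \<in> M" for u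
      using unique_paths_triangle[OF up3 E(2), of "f u" u "g u"] fg[OF that] sy by auto
    then show "N \<inter> E = {}" "N\<inverse> \<inter> E = {}" using sy by (auto simp: N_def)
  qed
  have "inj_on (\<lambda>u. (f u, g u)) M" using uniq by (auto intro!: inj_onI)
  then have cN: "card N = card M" unfolding N_def by (rule card_image)
  have "N \<inter> N\<inverse> = {}"
  proof -
    have False if "u \<in> M" "v \<in> M" "f u = g v" "g u = f v" for u v
      using uniq[of u v] fg[OF that(1)] that by auto
    then show ?thesis by (auto simp: N_def)
  qed
  then have "card (N \<union> N\<inverse>) = 2 * card M"
    using finM cN by (subst card_Un_disjoint) (auto simp: N_def)
  then have cA: "card A = card (E \<inter> W \<times> W) + 2 * card M"
    unfolding A_def using finM NE E(3) by (subst card_Un_disjoint) (auto simp: N_def)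
  \<comment> \<open>The filter recovers \<open>p\<close> from its subdivision \<open>P\<close>. The
    last conjunct shows that a newly inserted vertex \<open>u\<close> is not yet on
    \<open>P\<close>: its pair contains the new first vertex \<open>a\<close>, which is not on
    \<open>p\<close>.\<close>
  have expand: "\<exists>P. gpath E P \<and> hd P = hd p \<and> last P = last p \<and> filter (\<lambda>y. y \<in> W) P = p \<and>
      length P + 1 \<le> 2 * length p \<and> (\<forall>u\<in>set P - W. u \<in> M \<and> {f u, g u} \<subseteq> set p)"
    if "gpath A p" "set p \<subseteq> W" for p
    using that
  proof (induction p)
    case (Cons a p)
    show ?case
    proof (cases "p = []")
      case True
      then show ?thesis using Cons.prems by (intro exI[of _ "[a]"]) (auto simp: gpath_def)
    next
      case False
      then have p: "gpath A p" "a \<notin> set p" "(a, hd p) \<in> A" "set p \<subseteq> W" "a \<in> W"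
        using Cons.prems by (auto simp: gpath_Cons)
      obtain P where P: "gpath E P" "hd P = hd p" "last P = last p" "filter (\<lambda>y. y \<in> W) P = p"
        "length P + 1 \<le> 2 * length p" "\<forall>u\<in>set P - W. u \<in> M \<and> {f u, g u} \<subseteq> set p"
        using Cons.IH[OF p(1,4)] by blast
      have ne: "P \<noteq> []" using P by (auto simp: gpath_def)
      have aP: "a \<notin> set P" using P(4) p(2,5) by auto
      show ?thesis
      proof (cases "(a, hd p) \<in> E")
        case True
        then show ?thesis using P p aP ne False by (intro exI[of _ "a # P"]) (auto simp: gpath_Cons)
      next
        case nE: False
        then have "\<exists>u\<in>M. (a, hd p) = (f u, g u) \<or> (a, hd p) = (g u, f u)"
          using p(3) by (auto simp: A_def N_def)
        then obtain u where u: "u \<in> M" "{f u, g u} = {a, hd p}" by fastforce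
        have "(a, u) \<in> E" "(u, hd p) \<in> E"
          using fg[OF u(1)] u(2) sy by (auto simp: doubleton_eq_iff)
        moreover have "u \<notin> set P"
        proof
          assume "u \<in> set P"
          then have "{f u, g u} \<subseteq> set p" using P(6) MW[OF u(1)] by blast
          then show False using u(2) p(2) by simp
        qed
        moreover have "u \<noteq> a" using MW[OF u(1)] p(5) by auto
        moreover have "{f u, g u} \<subseteq> set (a # p)" unfolding u(2) using False by simp
        then have "\<forall>w\<in>set (a # u # P) - W. w \<in> M \<and> {f w, g w} \<subseteq> set (a # p)"
          using P(6) u(1) p(5) by auto
        ultimately show ?thesis using P(1-5) p(5) aP ne False MW[OF u(1)]
          by (intro exI[of _ "a # u # P"] conjI; (assumption | simp add: gpath_Cons))
      qed
    qed
  qed (simp add: gpath_def)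
  have "A \<subseteq> W \<times> W" using fg by (auto simp: A_def N_def)
  moreover have "sym A" using sy by (auto simp: A_def sym_def)
  moreover have "irrefl A" using fg E(2) by (force simp: A_def N_def irrefl_def)
  moreover have "unique_paths A (2 * q)"
    unfolding unique_paths_def
  proof (intro allI impI, elim conjE)
    fix p p' assume p: "gpath A p" "gpath A p'" "hd p = hd p'" "last p = last p'"
      and len: "length p + length p' \<le> 2 * q + 2"
    show "p = p'"
    \<comment> \<open>A path of one vertex may lie outside \<open>W\<close>, where
      \<open>expand\<close> does not apply.\<close>
    proof (cases "hd p = last p")
      case True
      then show ?thesis using gpath_hd_last p by metis
    next
      case False
      have *: "set r \<subseteq> W" if "gpath A r" "hd r \<noteq> last r" for r
      proof -
        from that obtain a r' where "r = a # r'" "r' \<noteq> []" by (cases r) (auto simp: gpath_def split: if_splits)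
        then have "hd r \<in> W" using that \<open>A \<subseteq> W \<times> W\<close> by (auto simp: gpath_Cons)
        then show ?thesis using gpath_subset that \<open>A \<subseteq> W \<times> W\<close> by metis
      qed
      obtain P where P: "gpath E P" "hd P = hd p" "last P = last p" "filter (\<lambda>y. y \<in> W) P = p"
        "length P + 1 \<le> 2 * length p"
        using expand[OF p(1) *[OF p(1) False]] by blast
      have False': "hd p' \<noteq> last p'" using False p by simp
      obtain P' where P': "gpath E P'" "hd P' = hd p'" "last P' = last p'" "filter (\<lambda>y. y \<in> W) P' = p'"
        "length P' + 1 \<le> 2 * length p'"
        using expand[OF p(2) *[OF p(2) False']] by blast
      \<comment> \<open>The lengths add up to at most
        \<open>2 * (2 * q + 2) - 2 = 4 * q + 2\<close>, just what \<open>up\<close> permits.\<close>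
      have "P = P'" using P P' p len by (intro unique_pathsD[OF up]) auto
      then show ?thesis using P P' by simp
    qed
  qed
  ultimately have "real (card A) + 2 \<le> 2 * x * real (card W)"
    using moore_bound[of W A q x] W q x by blast
  \<comment> \<open>\<open>W\<close> spans at least \<open>2 * card W - 2\<close> arcs, and the
    \<open>+ 2\<close> of the Moore bound makes up for the missing two. Each vertex of
    \<open>M\<close> adds two arcs, so halving gives the claim.\<close>
  then show ?thesis using cA edges by (simp add: M_def)
qed

section \<open>Greedy rainbow embedding of trees\<close>

lemma card_arcs_insert_leaf:
  assumes "finite W" "sym E" "u \<notin> W" "v \<in> W" "(v, u) \<in> E"
  shows "card (E \<inter> W \<times> W) + 2 \<le> card (E \<inter> insert u W \<times> insert u W)"
proof -
  let ?S = "insert (u, v) (insert (v, u) (E \<inter> W \<times> W))"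
  have "card (E \<inter> W \<times> W) + 2 = card ?S"
    using assms by (subst card_insert_disjoint; auto)+
  also have "\<dots> \<le> card (E \<inter> insert u W \<times> insert u W)"
    using assms by (intro card_mono) (auto dest: symD)
  finally show ?thesis .
qed

(* The unused colours from L upwards are accounted for by vertices of multi_nbrs; these keep that
   role as the image grows, so no colour is ever charged twice. *)
definition rainbow_embedding ::
  "('b \<times> 'b) set \<Rightarrow> ('a \<times> 'a) set \<Rightarrow> 'a set \<Rightarrow> ('a \<Rightarrow> nat) \<Rightarrow> nat \<Rightarrow> 'b set \<Rightarrow> ('b \<Rightarrow> 'a) \<Rightarrow> nat \<Rightarrow> bool"
  where
  "rainbow_embedding F E V c k X f L \<longleftrightarrow>
     inj_on f X \<and> f ` X \<subseteq> V \<and> inj_on c (f ` X) \<and>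
     (\<forall>x\<in>X. \<forall>y\<in>X. (x, y) \<in> F \<longleftrightarrow> (f x, f y) \<in> E) \<and>
     2 * card X \<le> card (E \<inter> f ` X \<times> f ` X) + 2 \<and>
     (\<forall>x\<in>X. L \<le> c (f x)) \<and>
     (\<forall>j. L \<le> j \<and> j < k \<longrightarrow> j \<in> c ` f ` X \<or> j \<in> c ` multi_nbrs E (f ` X))"

text \<open>A proper coloring with this property is known as a Grundy coloring, as produced by
  first-fit.\<close>

definition greedy_coloring :: "('a \<times> 'a) set \<Rightarrow> 'a set \<Rightarrow> ('a \<Rightarrow> nat) \<Rightarrow> bool" where
  "greedy_coloring E V c \<longleftrightarrow>
     (\<forall>v\<in>V. \<forall>j<c v. \<exists>u\<in>V. (v, u) \<in> E \<and> c u = j)"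

text \<open>If no colour below that of \<open>f x\<close> were available, each of them would occur
  on the image or on \<open>multi_nbrs\<close>. The invariant says the same of the colours from
  \<open>L\<close> on, so all \<open>k\<close> colours would be covered, against
  \<open>few\<close>.\<close>

lemma rainbow_embedding_extend:
  assumes E: "sym E" "irrefl E" "finite E" and c: "greedy_coloring E V c"
    and F: "sym F" "irrefl F"
    and emb: "rainbow_embedding F E V c k X f L" and X: "finite X"
    and t: "t \<notin> X" "x \<in> X" "(x, t) \<in> F" "\<And>y. y \<in> X \<Longrightarrow> (y, t) \<in> F \<Longrightarrow> y = x"
    and few: "card X + card (multi_nbrs E (f ` X)) < k"
  shows "\<exists>f' L'. rainbow_embedding F E V c k (insert t X) f' L'"
proof -
  define W where "W = f ` X"
  define M where "M = multi_nbrs E W"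
  define v where "v = f x"
  have f: "inj_on f X" "W \<subseteq> V" "inj_on c W" "\<And>x y. x \<in> X \<Longrightarrow> y \<in> X \<Longrightarrow> (x, y) \<in> F \<longleftrightarrow> (f x, f y) \<in> E"
    "2 * card X \<le> card (E \<inter> W \<times> W) + 2"
    "\<And>w. w \<in> W \<Longrightarrow> L \<le> c w" "\<And>j. L \<le> j \<Longrightarrow> j < k \<Longrightarrow> j \<in> c ` W \<or> j \<in> c ` M"
    using emb by (auto simp: rainbow_embedding_def W_def M_def)
  have finW: "finite W" "finite M" using X E(3) by (auto simp: W_def M_def finite_multi_nbrs)
  have v: "v \<in> W" "v \<in> V" using t(2) f(2) by (auto simp: v_def W_def)
  define C where "C = {a. a < c v \<and> a \<notin> c ` W \<and> (\<exists>u\<in>V. (v, u) \<in> E \<and> c u = a \<and> u \<notin> M)}"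
  have nC: "a \<in> c ` W \<or> a \<in> c ` M" if "a < c v" "a \<notin> C" for a
    using c that v unfolding greedy_coloring_def C_def by blast
  have "C \<noteq> {}"
  proof
    assume "C = {}"
    have "j \<in> c ` W \<or> j \<in> c ` M" if "j < k" for j
    proof (cases "j < c v")
      case True
      then show ?thesis using nC \<open>C = {}\<close> by blast
    next
      case False
      then have "L \<le> j" using f(6)[OF v(1)] by simp
      then show ?thesis using f(7) that by blast
    qed
    then have "{..<k} \<subseteq> c ` W \<union> c ` M" by blast
    then have "k \<le> card (c ` W \<union> c ` M)"
      using finW card_mono[of "c ` W \<union> c ` M" "{..<k}"] by simp
    also have "\<dots> \<le> card (c ` W) + card (c ` M)" by (rule card_Un_le)
    also have "\<dots> \<le> card X + card M"
      using finW X by (intro add_mono) (auto simp: W_def image_image intro: card_image_le)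
    finally show False using few by (simp add: M_def W_def)
  qed
  have finC: "finite C" by (rule finite_subset[of _ "{..<c v}"]) (auto simp: C_def)
  \<comment> \<open>With the largest candidate, every colour skipped between \<open>a\<close> and
    \<open>L\<close> lies below \<open>c v\<close> and is no candidate, hence is already accounted
    for.\<close>
  define a where "a = Max C"
  have a: "a \<in> C" "\<And>j. j \<in> C \<Longrightarrow> j \<le> a" using finC \<open>C \<noteq> {}\<close> by (auto simp: a_def)
  then obtain u where u: "u \<in> V" "(v, u) \<in> E" "c u = a" "u \<notin> M" "a \<notin> c ` W" "a < c v"
    by (auto simp: C_def)
  have uW: "u \<notin> W" using u by auto
  \<comment> \<open>Having no second neighbour in \<open>W\<close> is what keeps the copy
    induced.\<close>
  have only: "w = v" if "w \<in> W" "(w, u) \<in> E" for w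
    using that u v uW by (auto simp: M_def multi_nbrs_def)
  define f' where "f' = f(t := u)"
  have f'X: "f' ` insert t X = insert u W" "\<And>y. y \<in> X \<Longrightarrow> f' y = f y" "f' t = u"
    using t(1) by (auto simp: f'_def W_def)
  have "rainbow_embedding F E V c k (insert t X) f' (min L a)"
    unfolding rainbow_embedding_def f'X
  proof (intro conjI)
    have "inj_on f' X" using f(1) f'X(2) by (metis inj_on_cong)
    moreover have "f' t \<notin> f' ` (X - {t})" using uW f'X t(1) by (auto simp: W_def)
    ultimately show "inj_on f' (insert t X)" by simp
    show "insert u W \<subseteq> V" using f(2) u by auto
    show "inj_on c (insert u W)" using f(3) u uW by auto
    have tF: "(y, t) \<in> F \<longleftrightarrow> (f y, u) \<in> E" if "y \<in> X" for y
      using t that only[of "f y"] u(2) f(1) unfolding W_def v_def by (metis image_eqI inj_onD)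
    have tF': "(t, y) \<in> F \<longleftrightarrow> (u, f y) \<in> E" if "y \<in> X" for y
      using tF[OF that] E(1) F(1) by (meson symD)
    show "\<forall>x\<in>insert t X. \<forall>y\<in>insert t X. (x, y) \<in> F \<longleftrightarrow> (f' x, f' y) \<in> E"
      using tF tF' f(4) F(2) E(2) by (auto simp: f'X irrefl_def)
    show "2 * card (insert t X) \<le> card (E \<inter> insert u W \<times> insert u W) + 2"
      using card_arcs_insert_leaf[OF finW(1) E(1) uW v(1) u(2)] f(5) X t(1) by simp
    show "\<forall>x\<in>insert t X. min L a \<le> c (f' x)"
      using f(6) u f'X by (auto simp: W_def intro: min.coboundedI1)
    \<comment> \<open>Only \<open>u\<close> joins the image and \<open>u\<close> is not in
      \<open>M\<close>, so the vertices charged so far stay outside the image.\<close>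
    have mono: "M \<subseteq> multi_nbrs E (insert u W)"
      using u(4) by (auto simp: M_def multi_nbrs_def)
    show "\<forall>j. min L a \<le> j \<and> j < k \<longrightarrow> j \<in> c ` insert u W \<or> j \<in> c ` multi_nbrs E (insert u W)"
    proof (intro allI impI)
      fix j assume j: "min L a \<le> j \<and> j < k"
      consider "L \<le> j" | "j = a" | "a < j" "j < L" using j by linarith
      then have "j = a \<or> j \<in> c ` W \<or> j \<in> c ` M"
      proof cases
        case 3
        then have "j \<notin> C" "j < c v" using a(2) f(6)[OF v(1)] by fastforce+
        then show ?thesis using nC by blast
      qed (use f(7) j in auto)
      then show "j \<in> c ` insert u W \<or> j \<in> c ` multi_nbrs E (insert u W)"
        using mono u(3) by auto
    qed
  qed
  then show ?thesis by blast
qed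

section \<open>Growing a tree leaf by leaf\<close>

definition connected_on :: "('a \<times> 'a) set \<Rightarrow> 'a set \<Rightarrow> bool" where
  "connected_on F X \<longleftrightarrow>
     (\<forall>x\<in>X. \<forall>y\<in>X. \<exists>p. gpath F p \<and> hd p = x \<and> last p = y \<and> set p \<subseteq> X)"

lemma connected_on_insert:
  assumes "sym F" "connected_on F X" "x \<in> X" "(x, t) \<in> F" "t \<notin> X"
  shows "connected_on F (insert t X)"
proof -
  have to: "\<exists>p. gpath F p \<and> hd p = y \<and> last p = t \<and> set p \<subseteq> insert t X" if y: "y \<in> insert t X" for y
  proof (cases "y = t")
    case True
    then show ?thesis by (intro exI[of _ "[t]"]) (auto simp: gpath_def)
  next
    case False
    then obtain p where "gpath F p" "hd p = y" "last p = x" "set p \<subseteq> X"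
      using assms y unfolding connected_on_def by blast
    moreover from this have "p \<noteq> []" by (simp add: gpath_def)
    ultimately show ?thesis
      using assms by (intro exI[of _ "p @ [t]"]) (auto simp: gpath_snoc)
  qed
  have from_t: "\<exists>p. gpath F p \<and> hd p = t \<and> last p = y \<and> set p \<subseteq> insert t X" if y: "y \<in> insert t X" for y
  proof -
    obtain p where "gpath F p" "hd p = y" "last p = t" "set p \<subseteq> insert t X" using to[OF y] by blast
    then show ?thesis
      using gpath_rev[OF assms(1)] by (intro exI[of _ "rev p"]) (auto simp: hd_rev last_rev)
  qed
  show ?thesis
    unfolding connected_on_def
  proof (intro ballI)
    fix y z assume "y \<in> insert t X" "z \<in> insert t X"
    then consider "z = t" | "y = t" | "y \<in> X" "z \<in> X" by blast
    then show "\<exists>p. gpath F p \<and> hd p = y \<and> last p = z \<and> set p \<subseteq> insert t X"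
    proof cases
      case 3
      then show ?thesis using assms(2) unfolding connected_on_def by blast
    qed (use to from_t \<open>y \<in> _\<close> \<open>z \<in> _\<close> in auto)
  qed
qed

text \<open>A path inside \<open>X\<close> between two neighbours of \<open>t\<close> would be
  closed to a cycle by \<open>t\<close>. This is why \<open>connected_on\<close> confines its paths
  to \<open>X\<close>.\<close>

lemma acyclic_unique_attachment:
  assumes F: "sym F" "\<And>p. gpath F p \<Longrightarrow> 3 \<le> length p \<Longrightarrow> (last p, hd p) \<notin> F"
    and X: "connected_on F X" "x \<in> X" "y \<in> X" "t \<notin> X" "(x, t) \<in> F" "(y, t) \<in> F"
  shows "y = x"
proof (rule ccontr)
  assume "y \<noteq> x"
  obtain p where p: "gpath F p" "hd p = x" "last p = y" "set p \<subseteq> X"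
    using X unfolding connected_on_def by blast
  then obtain p' where p': "p = x # p'" "p' \<noteq> []"
    using \<open>y \<noteq> x\<close> by (cases p) (auto simp: gpath_def split: if_splits)
  have "gpath F (p @ [t])" using p X by (auto simp: gpath_snoc)
  moreover have "3 \<le> length (p @ [t])" using p' by (cases p') auto
  ultimately have "(last (p @ [t]), hd (p @ [t])) \<notin> F" by (rule F(2))
  then show False using p' F(1) X(5) by (auto dest: symD)
qed

text \<open>A connected part of \<open>Y\<close> grows from one vertex: the arc leaving it supplies
  the next leaf, and acyclicity makes its attachment unique.\<close>

lemma rainbow_embedding_exists:
  assumes E: "sym E" "irrefl E" "finite E" and c: "greedy_coloring E V c"
    and top: "v \<in> V" "k = Suc (c v)"
    and F: "sym F" "irrefl F" "\<And>p. gpath F p \<Longrightarrow> 3 \<le> length p \<Longrightarrow> (last p, hd p) \<notin> F"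
    and Y: "finite Y" "Y \<noteq> {}" "\<And>X. X \<subset> Y \<Longrightarrow> X \<noteq> {} \<Longrightarrow> \<exists>x\<in>X. \<exists>t\<in>Y - X. (x, t) \<in> F"
    and few: "\<And>W. W \<subseteq> V \<Longrightarrow> W \<noteq> {} \<Longrightarrow> finite W \<Longrightarrow> card W < card Y \<Longrightarrow>
                2 * card W \<le> card (E \<inter> W \<times> W) + 2 \<Longrightarrow> card W + card (multi_nbrs E W) < k"
  shows "\<exists>f L. rainbow_embedding F E V c k Y f L"
proof -
  have "\<exists>X f L. X \<subseteq> Y \<and> card X = Suc m \<and> connected_on F X \<and> rainbow_embedding F E V c k X f L"
    if "Suc m \<le> card Y" for m
    using that
  proof (induction m)
    case 0
    obtain y where "y \<in> Y" using Y by blast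
    moreover have "connected_on F {y}"
      unfolding connected_on_def by (auto simp: gpath_def intro!: exI[of _ "[y]"])
    \<comment> \<open>As \<open>k = Suc (c v)\<close>, the only colour from \<open>c v\<close> up to
      \<open>k\<close> is that of \<open>v\<close> itself.\<close>
    moreover have "rainbow_embedding F E V c k {y} (\<lambda>_. v) (c v)"
      using top E(2) F(2) by (auto simp: rainbow_embedding_def irrefl_def)
    ultimately show ?case by (intro exI[of _ "{y}"]) auto
  next
    case (Suc m)
    then obtain X f L where X: "X \<subseteq> Y" "card X = Suc m" "connected_on F X"
      and emb: "rainbow_embedding F E V c k X f L" by auto
    have finX: "finite X" and neX: "X \<noteq> {}" using X Y by (auto intro: finite_subset)
    have "X \<subset> Y" using X Suc.prems by auto
    then obtain x t where xt: "x \<in> X" "t \<in> Y" "t \<notin> X" "(x, t) \<in> F" using Y(3) neX by blast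
    have cf: "card (f ` X) = card X"
      using emb by (auto simp: rainbow_embedding_def intro: card_image)
    have "card (f ` X) + card (multi_nbrs E (f ` X)) < k"
      using emb finX neX X Suc.prems cf by (intro few) (auto simp: rainbow_embedding_def)
    then obtain f' L' where "rainbow_embedding F E V c k (insert t X) f' L'"
      using rainbow_embedding_extend[OF E c F(1,2) emb finX xt(3,1,4)]
        acyclic_unique_attachment[OF F(1) F(3) X(3) xt(1) _ xt(3,4)] cf by auto
    moreover have "connected_on F (insert t X)"
      using connected_on_insert[OF F(1) X(3)] xt by blast
    moreover have "card (insert t X) = Suc (Suc m)" using X finX xt by simp
    ultimately show ?case using X xt by (intro exI[of _ "insert t X"]) auto
  qed
  from this[of "card Y - 1"] obtain X f L where "X \<subseteq> Y" "card X = card Y"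
    "rainbow_embedding F E V c k X f L"
    using Y by (auto simp: card_gt_0_iff Suc_leI)
  then show ?thesis using Y(1) card_subset_eq by metis
qed

section \<open>Graphs as symmetric digraphs\<close>

lemma (in wf_digraph) ex_awalk_through:
  assumes "p \<noteq> []" "successively (\<lambda>x y. (x, y) \<in> arcs_ends G) p" "hd p \<in> verts G"
  shows "\<exists>es. awalk (hd p) es (last p) \<and> awalk_verts (hd p) es = p"
  using assms
proof (induction p)
  case (Cons a p)
  show ?case
  proof (cases "p = []")
    case True
    then show ?thesis using Cons.prems by (intro exI[of _ "[]"]) (auto simp: awalk_simps)
  next
    case False
    then have p: "successively (\<lambda>x y. (x, y) \<in> arcs_ends G) p" "(a, hd p) \<in> arcs_ends G"
      using Cons.prems by (cases p; auto)+
    then obtain e where e: "e \<in> arcs G" "tail G e = a" "head G e = hd p" by (auto elim: reachableE)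
    then obtain es where "awalk (hd p) es (last p)" "awalk_verts (hd p) es = p"
      using Cons.IH False p(1) head_in_verts[of e] by auto
    then show ?thesis using e False by (intro exI[of _ "e # es"]) (auto simp: awalk_Cons_iff)
  qed
qed simp

text \<open>Passes from vertex lists to arc lists, in which \<open>girth\<close> and
  \<open>undirected_tree\<close> express cycles.\<close>

lemma (in wf_digraph) undirected_cycle_of_gpath:
  assumes "gpath (arcs_ends G) p" "(last p, hd p) \<in> arcs_ends G" "3 \<le> length p"
  shows "\<exists>es. undirected_cycle G es \<and> length es = length p"
proof -
  obtain a p' where p: "p = a # p'" "p' \<noteq> []" using assms(3) by (cases p; cases "tl p") auto
  have "successively (\<lambda>x y. (x, y) \<in> arcs_ends G) (p @ [a])"
    using assms(1,2) p successively_append_iff[of "\<lambda>x y. (x, y) \<in> arcs_ends G" p "[a]"]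
    by (simp add: gpath_def)
  moreover have "a \<in> verts G" using assms(2) p by (auto dest: adj_in_verts)
  ultimately obtain es where es: "awalk a es a" "awalk_verts a es = p @ [a]"
    using ex_awalk_through[of "p @ [a]"] p by auto
  have len: "length es = length p" using arg_cong[OF es(2), of length] by (simp add: length_awalk_verts)
  have "distinct (tl (awalk_verts a es))" using es(2) p assms(1) by (auto simp: gpath_def)
  then have "cycle es" using es len p by (auto simp: cycle_def)
  then show ?thesis using len assms(3) by (auto simp: undirected_cycle_def)
qed

lemma (in graph) arcs_ends_simple:
  "sym (arcs_ends G)" "irrefl (arcs_ends G)" "finite (arcs_ends G)" "arcs_ends G \<subseteq> verts G \<times> verts G"
  using sym_arcs adj_not_same by (auto simp: symmetric_def irrefl_def arcs_ends_def arc_to_ends_def)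

lemma (in graph) unique_paths_girth:
  assumes "enat n < girth G"
  shows "unique_paths (arcs_ends G) n"
proof (rule unique_pathsI[OF arcs_ends_simple(1)])
  fix c assume "gpath (arcs_ends G) c" "(last c, hd c) \<in> arcs_ends G" "3 \<le> length c"
  then obtain es where "undirected_cycle G es" "length es = length c"
    using undirected_cycle_of_gpath by blast
  then have "girth G \<le> enat (length c)" unfolding girth_def by (metis INF_lower mem_Collect_eq)
  then show "n < length c" using assms by (metis enat_ord_simps(2) less_le_trans)
qed

lemma (in graph) card_common_neighbours_K2_free:
  assumes "K2_free r G" "0 < r" "a \<noteq> b"
  shows "card {u. (a, u) \<in> arcs_ends G \<and> (b, u) \<in> arcs_ends G} < r"
proof (rule ccontr)
  let ?E = "arcs_ends G"
  assume "\<not> ?thesis"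
  then obtain S where S: "S \<subseteq> {u. (a, u) \<in> ?E \<and> (b, u) \<in> ?E}" "card S = r" "finite S"
    by (meson not_less obtain_subset_with_card_n)
  have sy: "(y, x) \<in> ?E" if "(x, y) \<in> ?E" for x y using that arcs_ends_simple(1) by (meson symD)
  have ab: "a \<notin> S" "b \<notin> S" using S arcs_ends_simple(2) by (auto simp: irrefl_def)
  define D where "D = {a, b} \<times> S \<union> S \<times> {a, b}"
  have DE: "D \<subseteq> ?E" using S sy by (auto simp: D_def)
  \<comment> \<open>Only arcs between the two sides are kept, as an edge inside a side would spoil
    bipartiteness.\<close>
  define H where "H = \<lparr>verts = {a, b} \<union> S, arcs = {e \<in> arcs G. arc_to_ends G e \<in> D},
    tail = tail G, head = head G\<rparr>"
  have H: "verts H = {a, b} \<union> S" "arcs H = {e \<in> arcs G. arc_to_ends G e \<in> D}" "tail H = tail G" "head H = head G"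
    by (simp_all add: H_def)
  have ends: "arcs_ends H = D"
    using DE by (auto simp: arcs_ends_def arc_to_ends_def H)
  have "graph H"
  proof unfold_locales
    fix e assume "e \<in> arcs H"
    then show "tail H e \<in> verts H" "head H e \<in> verts H" "tail H e \<noteq> head H e"
      using ab by (auto simp: H D_def arc_to_ends_def)
  next
    show "finite (verts H)" "finite (arcs H)" using S by (auto simp: H)
    show "symmetric H" unfolding symmetric_def ends D_def by (auto simp: sym_def)
    show "e1 = e2" if "e1 \<in> arcs H" "e2 \<in> arcs H" "arc_to_ends H e1 = arc_to_ends H e2" for e1 e2
      using that no_multi_arcs[of e1 e2] by (auto simp: H arc_to_ends_def)
  qed
  moreover have "subgraph H G"
  proof -
    \<comment> \<open>An arc to some element of \<open>S\<close> shows that \<open>a\<close> and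
      \<open>b\<close> are vertices of \<open>G\<close>.\<close>
    have "S \<noteq> {}" using S(2) \<open>0 < r\<close> by auto
    then have "{a, b} \<union> S \<subseteq> verts G" using S(1) arcs_ends_simple(4) by auto
    then show ?thesis
      using \<open>graph H\<close> wf_digraph_axioms
      by (auto simp: subgraph_def H compatible_def graph_def digraph_def fin_digraph_def)
  qed
  moreover have "complete_bipartite_digraph 2 r H"
    unfolding complete_bipartite_digraph_def ends D_def H(1)
    using \<open>graph H\<close> S(2) ab \<open>a \<noteq> b\<close>
    by (intro conjI exI[of _ "{a, b}"] exI[of _ S]) simp_all
  ultimately show False using assms(1) unfolding K2_free_def by blast
qed

text \<open>Take the least colour sum among proper colorings with colours below the chromatic
  number. If \<open>v\<close> had no neighbour of a smaller colour \<open>j\<close>, recoloring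
  \<open>v\<close> with \<open>j\<close> would lower the sum.\<close>

lemma (in graph) ex_greedy_optimal_coloring:
  "\<exists>c. optimal_coloring G c \<and> c ` verts G = {..<chromatic_number G} \<and>
       greedy_coloring (arcs_ends G) (verts G) c"
proof -
  let ?V = "verts G" and ?k = "chromatic_number G"
  have chrom: "\<exists>c. proper_coloring G c \<and> card (c ` ?V) = ?k"
  proof -
    \<comment> \<open>An injective coloring shows that the minimum defining
      \<open>chromatic_number\<close> is attained.\<close>
    obtain f :: "'a \<Rightarrow> nat" where "inj_on f ?V" using finite_imp_inj_to_nat_seg finite_verts by blast
    then have "proper_coloring G f"
      using arcs_ends_simple(2,4) by (auto simp: proper_coloring_def irrefl_def inj_on_def)
    then have "\<exists>k c. proper_coloring G c \<and> card (c ` ?V) = k" by blast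
    from LeastI_ex[OF this] show ?thesis by (simp only: chromatic_number_def)
  qed
  have le: "?k \<le> card (c ` ?V)" if "proper_coloring G c" for c
    unfolding chromatic_number_def by (rule Least_le) (use that in blast)
  define P where "P c \<longleftrightarrow> proper_coloring G c \<and> c ` ?V \<subseteq> {..<?k}" for c
  have "\<exists>c. P c"
  proof -
    obtain c where c: "proper_coloring G c" "card (c ` ?V) = ?k" using chrom by blast
    \<comment> \<open>Renumbers the colours as an initial segment of the naturals.\<close>
    obtain h where h: "bij_betw h (c ` ?V) {0..<?k}"
      using ex_bij_betw_finite_nat[of "c ` ?V"] c(2) by auto
    have "proper_coloring G (h \<circ> c)"
      unfolding proper_coloring_def
    proof clarify
      fix u v assume "(u, v) \<in> arcs_ends G" "(h \<circ> c) u = (h \<circ> c) v"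
      moreover from this have "u \<in> ?V" "v \<in> ?V" using arcs_ends_simple(4) by auto
      ultimately show False
        using c(1) h unfolding proper_coloring_def bij_betw_def inj_on_def by fastforce
    qed
    moreover have "(h \<circ> c) ` ?V \<subseteq> {..<?k}" using h by (auto simp: bij_betw_def)
    ultimately show ?thesis unfolding P_def by blast
  qed
  then obtain c where c: "P c" "\<And>d. P d \<Longrightarrow> sum c ?V \<le> sum d ?V"
    using ex_has_least_nat[of P _ "\<lambda>c. sum c ?V"] by blast
  then have pc: "proper_coloring G c" "c ` ?V \<subseteq> {..<?k}" by (auto simp: P_def)
  then have "card (c ` ?V) = ?k"
    using le[of c] card_mono[of "{..<?k}" "c ` ?V"] by simp
  moreover from this have "c ` ?V = {..<?k}" using pc card_subset_eq[of "{..<?k}" "c ` ?V"] by simp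
  moreover have "greedy_coloring (arcs_ends G) ?V c"
    unfolding greedy_coloring_def
  proof (intro ballI allI impI, rule ccontr)
    fix v j assume v: "v \<in> ?V" "j < c v" and none: "\<not> (\<exists>u\<in>?V. (v, u) \<in> arcs_ends G \<and> c u = j)"
    have "proper_coloring G (c(v := j))"
      unfolding proper_coloring_def
    proof clarify
      fix x y assume xy: "(x, y) \<in> arcs_ends G" "(c(v := j)) x = (c(v := j)) y"
      moreover have "x \<noteq> y" "(y, x) \<in> arcs_ends G" "x \<in> ?V" "y \<in> ?V" "c x \<noteq> c y"
        using xy(1) arcs_ends_simple pc(1) by (auto simp: irrefl_def sym_def proper_coloring_def)
      ultimately show False using none by (auto split: if_splits)
    qed
    moreover have "(c(v := j)) ` ?V \<subseteq> {..<?k}"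
      using pc(2) v by (auto simp: image_subset_iff)
    ultimately have "P (c(v := j))" unfolding P_def by blast
    then have "sum c ?V \<le> sum (c(v := j)) ?V" by (rule c(2))
    moreover have "sum (c(v := j)) ?V < sum c ?V"
      using v by (intro sum_strict_mono_ex1) auto
    ultimately show False by simp
  qed
  ultimately show ?thesis using pc(1) by (auto simp: optimal_coloring_def)
qed

text \<open>Without such an arc, everything reachable from \<open>X\<close> would stay in
  \<open>X\<close>. Connectedness is stated for the symmetric closure, which has the same
  reachability as \<open>T\<close>.\<close>

lemma undirected_tree_leaving_arc:
  assumes "undirected_tree T" "X \<subset> verts T" "X \<noteq> {}"
  shows "\<exists>x\<in>X. \<exists>t\<in>verts T - X. (x, t) \<in> arcs_ends T"
proof (rule ccontr)
  interpret T: graph T using assms(1) by (simp add: undirected_tree_def)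
  assume none: "\<not> ?thesis"
  obtain x y where x: "x \<in> X" and y: "y \<in> verts T" "y \<notin> X" using assms(2,3) by blast
  have "x \<rightarrow>\<^sup>*\<^bsub>with_proj (mk_symmetric T)\<^esub> y"
    using assms(1,2) x y
    by (auto simp: undirected_tree_def connected_def strongly_connected_def)
  then have "x \<rightarrow>\<^sup>*\<^bsub>T\<^esub> y" using T.reachable_mk_symmetric_eq[OF T.sym_arcs] by simp
  then have "y \<in> X" unfolding reachable_def
  proof (induction rule: rtrancl_on_induct)
    case (step z w)
    then show ?case using none by blast
  qed (use x in simp)
  then show False using y by simp
qed

text \<open>An isomorphism must also map arcs. The absence of parallel arcs makes the chosen arc map
  \<open>\<phi>\<close> injective, and onto the arcs of the induced subgraph.\<close>

lemma digraph_iso_induce_subgraph: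
  assumes "graph T" "graph G" "inj_on f (verts T)" "f ` verts T \<subseteq> verts G"
    and "\<And>x y. x \<in> verts T \<Longrightarrow> y \<in> verts T \<Longrightarrow> (x, y) \<in> arcs_ends T \<longleftrightarrow> (f x, f y) \<in> arcs_ends G"
  shows "digraph_iso T (G \<restriction> (f ` verts T))"
proof -
  interpret T: graph T by fact
  interpret G: graph G by fact
  have "\<exists>e'. e' \<in> arcs G \<and> tail G e' = f (tail T e) \<and> head G e' = f (head T e)" if "e \<in> arcs T" for e
  proof -
    have "(tail T e, head T e) \<in> arcs_ends T" using that by (auto simp: arcs_ends_conv)
    then have "(f (tail T e), f (head T e)) \<in> arcs_ends G" using assms(5) that by simp
    then show ?thesis by (auto simp: arcs_ends_conv)
  qed
  then obtain \<phi> where \<phi>: "\<And>e. e \<in> arcs T \<Longrightarrow>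
      \<phi> e \<in> arcs G \<and> tail G (\<phi> e) = f (tail T e) \<and> head G (\<phi> e) = f (head T e)"
    by metis
  have inj: "inj_on \<phi> (arcs T)"
  proof (rule inj_onI)
    fix e e' assume e: "e \<in> arcs T" "e' \<in> arcs T" "\<phi> e = \<phi> e'"
    then have "f (tail T e) = f (tail T e')" "f (head T e) = f (head T e')" using \<phi> by metis+
    then have "arc_to_ends T e = arc_to_ends T e'"
      using assms(3) e by (auto simp: arc_to_ends_def dest: inj_onD)
    then show "e = e'" using e T.no_multi_arcs by blast
  qed
  have img: "\<phi> ` arcs T = {e \<in> arcs G. tail G e \<in> f ` verts T \<and> head G e \<in> f ` verts T}"
  proof (intro equalityI subsetI)
    fix e assume "e \<in> {e \<in> arcs G. tail G e \<in> f ` verts T \<and> head G e \<in> f ` verts T}"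
    then obtain x y where e: "e \<in> arcs G" "x \<in> verts T" "y \<in> verts T" "tail G e = f x" "head G e = f y"
      by auto
    then have "(f x, f y) \<in> arcs_ends G" by (auto simp: arcs_ends_conv intro!: image_eqI[of _ _ e])
    then have "(x, y) \<in> arcs_ends T" using assms(5) e by blast
    then obtain d where d: "d \<in> arcs T" "tail T d = x" "head T d = y" by (auto simp: arcs_ends_conv)
    then have "\<phi> d = e" using \<phi>[of d] e G.no_multi_arcs[of "\<phi> d" e] by (simp add: arc_to_ends_def)
    then show "e \<in> \<phi> ` arcs T" using d by blast
  qed (use \<phi> in auto)
  let ?h = "\<lparr>iso_verts = f, iso_arcs = \<phi>, iso_head = head G, iso_tail = tail G\<rparr>"
  have "T.digraph_isomorphism ?h"
    using \<phi> inj assms(3) T.wf_digraph by (auto simp: T.digraph_isomorphism_def)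
  moreover have "G \<restriction> (f ` verts T) = app_iso ?h T"
    by (simp add: induce_subgraph_def app_iso_def img)
  ultimately show ?thesis unfolding digraph_iso_def by blast
qed

section \<open>The counting bounds in the two cases\<close>

lemma card_multi_nbrs_K2_free:
  assumes "graph G" "K2_free r G" "2 \<le> r" "finite W" "card W < s"
    and k: "(real r - 1) * (real s - 1) * real s / 2 + real s \<le> real k"
  shows "card W + card (multi_nbrs (arcs_ends G) W) < k"
proof -
  interpret graph G by fact
  let ?E = "arcs_ends G" and ?m = "card W"
  have "card (multi_nbrs ?E W) \<le> (?m choose 2) * (r - 1)"
  proof (rule card_multi_nbrs_le_choose[OF assms(4)])
    fix a b :: 'a assume "a \<noteq> b"
    have "finite {u. (a, u) \<in> ?E \<and> (b, u) \<in> ?E}"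
      using arcs_ends_simple(4) by (auto intro: finite_subset[OF _ finite_verts])
    then show "finite {u. (a, u) \<in> ?E \<and> (b, u) \<in> ?E} \<and> card {u. (a, u) \<in> ?E \<and> (b, u) \<in> ?E} \<le> r - 1"
      using card_common_neighbours_K2_free[OF assms(2) _ \<open>a \<noteq> b\<close>] assms(3) by simp
  qed
  then have "real (card (multi_nbrs ?E W)) \<le> real ((?m choose 2) * (r - 1))" by (rule of_nat_mono)
  also have "\<dots> = real (?m choose 2) * (real r - 1)" using assms(3) by (simp add: of_nat_diff)
  also have "\<dots> \<le> (real ?m * (real ?m - 1) / 2) * (real r - 1)"
  proof (rule mult_right_mono)
    show "real (?m choose 2) \<le> real ?m * (real ?m - 1) / 2"
      using of_nat_div_le_of_nat[of "?m * (?m - 1)" 2, where ?'a = real] by (cases ?m) (simp_all add: choose_two algebra_simps)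
  qed (use assms(3) in simp)
  also have "\<dots> \<le> (real s * (real s - 1) / 2) * (real r - 1)"
  proof (intro mult_right_mono divide_right_mono)
    show "real ?m * (real ?m - 1) \<le> real s * (real s - 1)"
      using assms(5) by (cases ?m) (auto intro!: mult_mono)
  qed (use assms(3) in auto)
  finally have "real (card (multi_nbrs ?E W)) \<le> (real r - 1) * (real s - 1) * real s / 2"
    by (simp add: algebra_simps)
  \<comment> \<open>The summand \<open>s\<close> covers the vertices of \<open>W\<close>, and
    \<open>card W < s\<close> makes the inequality strict.\<close>
  then have "real (?m + card (multi_nbrs ?E W)) < real k" using k assms(5) by simp
  then show ?thesis by linarith
qed

lemma card_multi_nbrs_girth:
  assumes "graph G" "5 \<le> girth G" "real s powr girth_exponent (girth G) \<le> real k"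
    and W: "finite W" "W \<noteq> {}" "card W < s"
      "2 * card W \<le> card (arcs_ends G \<inter> W \<times> W) + 2"
  shows "card W + card (multi_nbrs (arcs_ends G) W) < k"
proof -
  interpret graph G by fact
  let ?E = "arcs_ends G" and ?m = "card W"
  note bound = card_multi_nbrs_le_power[OF arcs_ends_simple(1-3) W(1,2) _ _ _ _ W(4)]
  have m: "0 < ?m" using W by (simp add: card_gt_0_iff)
  show ?thesis
  proof (cases "girth G")
    case infinity
    \<comment> \<open>Infinite girth allows every \<open>q\<close>, so \<open>x\<close> can be so
      close to \<open>1\<close> that \<open>x * real ?m < real ?m + 1\<close>; then
      \<open>multi_nbrs\<close> is empty.\<close>
    define x :: real where "x = 1 + 1 / (real ?m + 1)"
    have x: "1 < x" by (simp add: x_def)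
    obtain q where "real ?m < x ^ q" using real_arch_pow[OF x] by blast
    also have "\<dots> \<le> x ^ Suc q" using x by (intro power_increasing) auto
    finally have "real ?m \<le> x ^ Suc q" by simp
    then have "real ?m + real (card (multi_nbrs ?E W)) \<le> x * real ?m"
      using x infinity by (intro bound[of "Suc q"] unique_paths_girth) auto
    also have "x * real ?m < real ?m + 1" by (simp add: x_def field_simps)
    finally have "?m + card (multi_nbrs ?E W) < Suc ?m" by linarith
    then show ?thesis using W(3) assms(3) infinity by (simp add: girth_exponent_def)
  next
    case (enat g)
    then have g: "5 \<le> g" using assms(2) by (simp add: numeral_eq_enat)
    \<comment> \<open>The largest \<open>q\<close> with \<open>4 * q < g\<close>. Rounding down
      still leaves \<open>g - 4 \<le> 4 * q\<close>, the source of the exponent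
      \<open>4 / (g - 4)\<close>.\<close>
    define q where "q = (g - 1) div 4"
    have q: "1 \<le> q" "4 * q \<le> g - 1" "g - 4 \<le> 4 * q" using g by (auto simp: q_def)
    \<comment> \<open>The value with \<open>x ^ q = s\<close>, so the bound
      \<open>x * card W\<close> stays below \<open>s powr (1 + 1 / q)\<close>.\<close>
    define x where "x = real s powr (1 / real q)"
    have s: "1 \<le> s" using W(3) by simp
    have x: "0 < x" using s by (simp add: x_def)
    have "x ^ q = real s"
      using q s x by (simp add: x_def powr_realpow[symmetric] powr_powr)
    then have "real ?m \<le> x ^ q" using W(3) by simp
    moreover have "unique_paths ?E (4 * q)"
      using q g enat by (intro unique_paths_girth) auto
    ultimately have "real ?m + real (card (multi_nbrs ?E W)) \<le> x * real ?m"
      using q x by (intro bound)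
    also have "\<dots> < x * real s" using x W(3) by simp
    also have "x * real s = real s powr (1 + 1 / real q)"
      using s by (simp add: x_def powr_add)
    also have "\<dots> \<le> real s powr (1 + 4 / (real g - 4))"
    proof (rule powr_mono)
      have "real g - 4 \<le> 4 * real q" using q(3) g by linarith
      then show "1 + 1 / real q \<le> 1 + 4 / (real g - 4)" using q(1) g by (simp add: field_simps)
    qed (use s in simp)
    also have "\<dots> \<le> real k" using assms(3) enat by (simp add: girth_exponent_def)
    finally show ?thesis by linarith
  qed
qed

(* The trees T live on vertices in nat: every finite tree is isomorphic to one of these, and
   a fixed vertex type lets one coloring c serve all trees on s vertices. *)
theorem theorem23:
  fixes G :: "('a, 'b) pre_digraph" and s :: nat
  assumes "graph G" and "1 \<le> s"
    and "(\<exists>r::nat. 2 \<le> r \<and> K2_free r G \<and>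
            (real r - 1) * (real s - 1) * real s / 2 + real s \<le> real (chromatic_number G))
       \<or> (5 \<le> girth G \<and>
            real s powr girth_exponent (girth G) \<le> real (chromatic_number G))"
  shows "\<exists>c. optimal_coloring G c \<and>
           (\<forall>T :: (nat, nat \<times> nat) pre_digraph.
              undirected_tree T \<and> card (verts T) = s \<longrightarrow> occurs_induced_rainbow T G c)"
proof -
  interpret graph G by fact
  let ?E = "arcs_ends G" and ?k = "chromatic_number G"
  obtain c where c: "optimal_coloring G c" "c ` verts G = {..<?k}" "greedy_coloring ?E (verts G) c"
    using ex_greedy_optimal_coloring by blast
  have few: "card W + card (multi_nbrs ?E W) < ?k"
    if "W \<noteq> {}" "finite W" "card W < s" "2 * card W \<le> card (?E \<inter> W \<times> W) + 2" for W
    using assms(3) card_multi_nbrs_K2_free[OF assms(1) _ _ that(2,3)]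
      card_multi_nbrs_girth[OF assms(1) _ _ that(2,1,3,4)] by blast
  \<comment> \<open>A positive chromatic number gives a vertex of the largest colour, where every
    embedding starts.\<close>
  have "0 < real ?k"
    using assms(3)
  proof (elim disjE exE conjE)
    fix r assume "2 \<le> r" "(real r - 1) * (real s - 1) * real s / 2 + real s \<le> real ?k"
    moreover from this assms(2) have "0 \<le> (real r - 1) * (real s - 1) * real s / 2" by simp
    ultimately show ?thesis using assms(2) by linarith
  next
    assume "real s powr girth_exponent (girth G) \<le> real ?k"
    moreover have "0 < real s powr girth_exponent (girth G)" using assms(2) by simp
    ultimately show ?thesis by linarith
  qed
  then obtain v where v: "v \<in> verts G" "?k = Suc (c v)"
    using c(2) by (metis Suc_pred imageE lessI lessThan_iff of_nat_0_less_iff)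
  \<comment> \<open>The coloring is fixed before the tree, so one coloring serves all trees.\<close>
  have "occurs_induced_rainbow T G c" if T: "undirected_tree T" "card (verts T) = s"
    for T :: "(nat, nat \<times> nat) pre_digraph"
  proof -
    interpret T: graph T using T by (simp add: undirected_tree_def)
    let ?F = "arcs_ends T"
    have "\<exists>f L. rainbow_embedding ?F ?E (verts G) c ?k (verts T) f L"
    proof (rule rainbow_embedding_exists[OF arcs_ends_simple(1-3) c(3) v T.arcs_ends_simple(1,2)])
      show "(last p, hd p) \<notin> ?F" if "gpath ?F p" "3 \<le> length p" for p
        using T.undirected_cycle_of_gpath that T(1) unfolding undirected_tree_def by blast
      show "verts T \<noteq> {}" using T(2) assms(2) by auto
    qed (use undirected_tree_leaving_arc[OF T(1)] few T(2) in auto)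
    then obtain f L where emb: "rainbow_embedding ?F ?E (verts G) c ?k (verts T) f L" by blast
    have "induced_subgraph (G \<restriction> (f ` verts T)) G"
      using emb by (intro induced_induce) (simp add: rainbow_embedding_def)
    moreover have "inj_on c (verts (G \<restriction> (f ` verts T)))"
      using emb by (simp add: rainbow_embedding_def)
    moreover have "digraph_iso T (G \<restriction> (f ` verts T))"
      using emb by (intro digraph_iso_induce_subgraph T.graph_axioms assms(1))
        (simp_all add: rainbow_embedding_def)
    ultimately show ?thesis unfolding occurs_induced_rainbow_def by blast
  qed
  then show ?thesis using c(1) by blast
qed

end
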